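(* The initial common meadow $\mathbb I(\Sigma_{cm},\mathrm{Md}_{\mathbf a})$ is isomorphic (as a $\Sigma_{cm}$-algebra) to $\mathbb{F}_{cm}(\mathbb Z)$.
   Context: Let $\Sigma_{cm}=\{0,1,\mathbf a,-(\_),(\_)^{-1},+,\cdot\}$ (three constants, two unary and two binary operations). $\mathrm{Md}_{\mathbf a}$ is the following set of equational axioms (universally quantified): $(x+y)+z=x+(y+z)$; $x+y=y+x$; $x+0=x$; $x+(-x)=0\cdot x$; $(x\cdot y)\cdot z=x\cdot(y\cdot z)$; $x\cdot y=y\cdot x$; $1\cdot x=x$; $x\cdot(y+z)=x\cdot y+x\cdot z$; $-(-x)=x$; $0\cdot(x\cdot x)=0\cdot x$; $(x^{-1})^{-1}=x+0\cdot x^{-1}$; $x\cdot x^{-1}=1+0\cdot x^{-1}$; $(x\cdot y)^{-1}=x^{-1}\cdot y^{-1}$; $1^{-1}=1$; $0^{-1}=\mathbf a$; $x+\mathbf a=\mathbf a$; $x\cdot\mathbf a=\mathbf a$. A common meadow is a $\Sigma_{cm}$-algebra satisfying $\mathrm{Md}_{\mathbf a}$. $\mathbb I(\Sigma_{cm},\mathrm{Md}_{\mathbf a})$ is the initial algebra of this equational specification: closed $\Sigma_{cm}$-terms modulo provable equality from $\mathrm{Md}_{\mathbf a}$ in equational logic. Let $F(\mathbb Z)=\mathbb Z\times\mathbb Z$, whose elements are called fracpairs and written $\frac pq$ (with $q=0$ allowed). Cc-equivalence $=_{cc}$ is the smallest equivalence relation on $F(\mathbb Z)$ such that $\frac{x\cdot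 z}{y\cdot(z\cdot z)}=_{cc}\frac{x}{y\cdot z}$ for all $x,y,z\in\mathbb Z$. On $F(\mathbb Z)$ define: $\frac xy+\frac uv=\frac{x\cdot v+u\cdot y}{y\cdot v}$, $\frac xy\cdot\frac uv=\frac{x\cdot u}{y\cdot v}$, $-\frac xy=\frac{-x}{y}$, $\left(\frac xy\right)^{-1}=\frac{y\cdot y}{x\cdot y}$, $0=\frac01$, $1=\frac11$, $\mathbf a=\frac10$. The relation $=_{cc}$ is a congruence for these operations, and $\mathbb{F}_{cm}(\mathbb Z)$ is the quotient $\Sigma_{cm}$-algebra $F(\mathbb Z)/{=_{cc}}$. *)

theory Defs
  imports Main
begin

section \<open>Algebras over the signature of common meadows\<close>

record 'a cm_alg =
  carr :: "'a set"
  zero_op :: 'a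
  one_op :: 'a
  err_op :: 'a  \<comment> \<open>the constant \<open>\<^bold>a\<close>\<close>
  neg_op :: "'a \<Rightarrow> 'a"
  inv_op :: "'a \<Rightarrow> 'a"
  add_op :: "'a \<Rightarrow> 'a \<Rightarrow> 'a"
  mul_op :: "'a \<Rightarrow> 'a \<Rightarrow> 'a"

definition cm_algebra :: "'a cm_alg \<Rightarrow> bool" where
  "cm_algebra A \<longleftrightarrow>
     zero_op A \<in> carr A \<and> one_op A \<in> carr A \<and> err_op A \<in> carr A \<and>
     (\<forall>x\<in>carr A. neg_op A x \<in> carr A) \<and>
     (\<forall>x\<in>carr A. inv_op A x \<in> carr A) \<and>
     (\<forall>x\<in>carr A. \<forall>y\<in>carr A. add_op A x y \<in> carr A) \<and>
     (\<forall>x\<in>carr A. \<forall>y\<in>carr A. mul_op A x y \<in> carr A)"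

definition cm_hom :: "'a cm_alg \<Rightarrow> 'b cm_alg \<Rightarrow> ('a \<Rightarrow> 'b) \<Rightarrow> bool" where
  "cm_hom A B h \<longleftrightarrow>
     (\<forall>x\<in>carr A. h x \<in> carr B) \<and>
     h (zero_op A) = zero_op B \<and> h (one_op A) = one_op B \<and> h (err_op A) = err_op B \<and>
     (\<forall>x\<in>carr A. h (neg_op A x) = neg_op B (h x)) \<and>
     (\<forall>x\<in>carr A. h (inv_op A x) = inv_op B (h x)) \<and>
     (\<forall>x\<in>carr A. \<forall>y\<in>carr A. h (add_op A x y) = add_op B (h x) (h y)) \<and>
     (\<forall>x\<in>carr A. \<forall>y\<in>carr A. h (mul_op A x y) = mul_op B (h x) (h y))"

definition cm_isomorphic :: "'a cm_alg \<Rightarrow> 'b cm_alg \<Rightarrow> bool" where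
  "cm_isomorphic A B \<longleftrightarrow> cm_algebra A \<and> cm_algebra B \<and>
     (\<exists>h. cm_hom A B h \<and> bij_betw h (carr A) (carr B))"

text \<open>
  The quotient of an algebra by a congruence. On equivalence classes, the unions below collapse to
  the class of the result on any representatives, as in theory \<open>Equiv_Relations\<close>; this
  depends on \<open>R\<close> being a congruence, which is shown below for both relations of interest.
\<close>

definition cm_quotient :: "'a cm_alg \<Rightarrow> ('a \<times> 'a) set \<Rightarrow> 'a set cm_alg" where
  "cm_quotient A R =
     \<lparr> carr = carr A // R,
       zero_op = R `` {zero_op A},
       one_op = R `` {one_op A},
       err_op = R `` {err_op A},
       neg_op = (\<lambda>X. \<Union>x\<in>X. R `` {neg_op A x}),
       inv_op = (\<lambda>X. \<Union>x\<in>X. R `` {inv_op A x}),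
       add_op = (\<lambda>X Y. \<Union>x\<in>X. \<Union>y\<in>Y. R `` {add_op A x y}),
       mul_op = (\<lambda>X Y. \<Union>x\<in>X. \<Union>y\<in>Y. R `` {mul_op A x y}) \<rparr>"

definition cm_congruence :: "'a cm_alg \<Rightarrow> ('a \<times> 'a) set \<Rightarrow> bool" where
  "cm_congruence A R \<longleftrightarrow> equiv (carr A) R \<and>
     (\<forall>(x, x') \<in> R. (neg_op A x, neg_op A x') \<in> R) \<and>
     (\<forall>(x, x') \<in> R. (inv_op A x, inv_op A x') \<in> R) \<and>
     (\<forall>(x, x') \<in> R. \<forall>(y, y') \<in> R. (add_op A x y, add_op A x' y') \<in> R) \<and>
     (\<forall>(x, x') \<in> R. \<forall>(y, y') \<in> R. (mul_op A x y, mul_op A x' y') \<in> R)"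


section \<open>Terms and equational logic\<close>

datatype (vars: 'v) cm_term =
    Var 'v
  | Zero
  | One
  | Err
  | Neg "'v cm_term"
  | Inv "'v cm_term"
  | Add "'v cm_term" "'v cm_term" (infixl "\<oplus>" 65)
  | Mul "'v cm_term" "'v cm_term" (infixl "\<odot>" 70)

primrec subst :: "('v \<Rightarrow> 'w cm_term) \<Rightarrow> 'v cm_term \<Rightarrow> 'w cm_term" where
  "subst \<sigma> (Var v) = \<sigma> v"
| "subst \<sigma> Zero = Zero"
| "subst \<sigma> One = One"
| "subst \<sigma> Err = Err"
| "subst \<sigma> (Neg s) = Neg (subst \<sigma> s)"
| "subst \<sigma> (Inv s) = Inv (subst \<sigma> s)"
| "subst \<sigma> (s \<oplus> t) = subst \<sigma> s \<oplus> subst \<sigma> t"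
| "subst \<sigma> (s \<odot> t) = subst \<sigma> s \<odot> subst \<sigma> t"

inductive provable ::
  "('v cm_term \<times> 'v cm_term) set \<Rightarrow> 'v cm_term \<Rightarrow> 'v cm_term \<Rightarrow> bool"
  for E where
  ax: "(s, t) \<in> E \<Longrightarrow> provable E s t"
| refl: "provable E t t"
| sym: "provable E s t \<Longrightarrow> provable E t s"
| trans: "provable E s t \<Longrightarrow> provable E t u \<Longrightarrow> provable E s u"
| cong_Neg: "provable E s t \<Longrightarrow> provable E (Neg s) (Neg t)"
| cong_Inv: "provable E s t \<Longrightarrow> provable E (Inv s) (Inv t)"
| cong_Add: "provable E s t \<Longrightarrow> provable E s' t' \<Longrightarrow> provable E (s \<oplus> s') (t \<oplus> t')"
| cong_Mul: "provable E s t \<Longrightarrow> provable E s' t' \<Longrightarrow> provable E (s \<odot> s') (t \<odot> t')"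
| inst: "provable E s t \<Longrightarrow> provable E (subst \<sigma> s) (subst \<sigma> t)"

definition Md_a :: "(nat cm_term \<times> nat cm_term) set" where
  "Md_a = (let x = Var 0; y = Var 1; z = Var 2 in
    { ((x \<oplus> y) \<oplus> z, x \<oplus> (y \<oplus> z)),
      (x \<oplus> y, y \<oplus> x),
      (x \<oplus> Zero, x),
      (x \<oplus> Neg x, Zero \<odot> x),
      ((x \<odot> y) \<odot> z, x \<odot> (y \<odot> z)),
      (x \<odot> y, y \<odot> x),
      (One \<odot> x, x),
      (x \<odot> (y \<oplus> z), x \<odot> y \<oplus> x \<odot> z),
      (Neg (Neg x), x),
      (Zero \<odot> (x \<odot> x), Zero \<odot> x),
      (Inv (Inv x), x \<oplus> Zero \<odot> Inv x),
      (x \<odot> Inv x, One \<oplus> Zero \<odot> Inv x),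
      (Inv (x \<odot> y), Inv x \<odot> Inv y),
      (Inv One, One),
      (Inv Zero, Err),
      (x \<oplus> Err, Err),
      (x \<odot> Err, Err) })"


section \<open>The initial common meadow\<close>

definition closed_term_alg :: "nat cm_term cm_alg" where
  "closed_term_alg =
     \<lparr> carr = {t. vars t = {}}, zero_op = Zero, one_op = One, err_op = Err,
       neg_op = Neg, inv_op = Inv, add_op = Add, mul_op = Mul \<rparr>"

definition provable_rel :: "(nat cm_term \<times> nat cm_term) set" where
  "provable_rel = {(s, t). vars s = {} \<and> vars t = {} \<and> provable Md_a s t}"

definition initial_cm :: "nat cm_term set cm_alg" where
  "initial_cm = cm_quotient closed_term_alg provable_rel"

lemma cm_congruence_provable_rel: "cm_congruence closed_term_alg provable_rel"
  unfolding cm_congruence_def closed_term_alg_def provable_rel_def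
  by (auto intro!: equivI refl_onI symI transI
      intro: provable.refl provable.sym provable.trans provable.cong_Neg provable.cong_Inv
        provable.cong_Add provable.cong_Mul)


section \<open>The common meadow of fracpairs over the integers\<close>

text \<open>A fracpair $\frac{p}{q}$ is the pair \<open>(p, q)\<close>; the denominator may be 0.\<close>

definition fracpair_alg :: "(int \<times> int) cm_alg" where
  "fracpair_alg =
     \<lparr> carr = UNIV, zero_op = (0, 1), one_op = (1, 1), err_op = (1, 0),
       neg_op = (\<lambda>(x, y). (- x, y)),
       inv_op = (\<lambda>(x, y). (y * y, x * y)),
       add_op = (\<lambda>(x, y) (u, v). (x * v + u * y, y * v)),
       mul_op = (\<lambda>(x, y) (u, v). (x * u, y * v)) \<rparr>"

inductive cc_equiv :: "int \<times> int \<Rightarrow> int \<times> int \<Rightarrow> bool" where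
  cancel: "cc_equiv (x * z, y * (z * z)) (x, y * z)"
| refl: "cc_equiv p p"
| sym: "cc_equiv p q \<Longrightarrow> cc_equiv q p"
| trans: "cc_equiv p q \<Longrightarrow> cc_equiv q r \<Longrightarrow> cc_equiv p r"

definition cc_rel :: "((int \<times> int) \<times> (int \<times> int)) set" where
  "cc_rel = {(p, q). cc_equiv p q}"

definition F_cm :: "(int \<times> int) set cm_alg" where
  "F_cm = cm_quotient fracpair_alg cc_rel"

lemma cc_equiv_neg: "cc_equiv p q \<Longrightarrow> cc_equiv (neg_op fracpair_alg p) (neg_op fracpair_alg q)"
proof (induction rule: cc_equiv.induct)
  case (cancel x z y)
  then show ?case
    using cc_equiv.cancel[of "- x" z y] by (simp add: fracpair_alg_def)
qed (auto intro: cc_equiv.intros)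

lemma cc_equiv_inv: "cc_equiv p q \<Longrightarrow> cc_equiv (inv_op fracpair_alg p) (inv_op fracpair_alg q)"
proof (induction rule: cc_equiv.induct)
  case (cancel x z y)
  have "cc_equiv (y * y * z * z * z * z, x * y * z * (z * z)) (y * y * z * z * z, x * y * z * z)"
    by (rule cc_equiv.cancel)
  moreover have "cc_equiv (y * y * z * z * z, x * y * (z * z)) (y * y * z * z, x * y * z)"
    by (rule cc_equiv.cancel)
  ultimately show ?case
    by (auto simp: fracpair_alg_def ac_simps intro: cc_equiv.trans)
qed (auto intro: cc_equiv.intros)

lemma cc_equiv_add_left:
  "cc_equiv p q \<Longrightarrow> cc_equiv (add_op fracpair_alg p r) (add_op fracpair_alg q r)"
proof (induction rule: cc_equiv.induct)
  case (cancel x z y)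
  obtain u v where r: "r = (u, v)" by (cases r)
  show ?case
    using cc_equiv.cancel[of "x * v + u * (y * z)" z "y * v"]
    by (simp add: r fracpair_alg_def algebra_simps)
qed (auto intro: cc_equiv.intros)

lemma cc_equiv_mul_left:
  "cc_equiv p q \<Longrightarrow> cc_equiv (mul_op fracpair_alg p r) (mul_op fracpair_alg q r)"
proof (induction rule: cc_equiv.induct)
  case (cancel x z y)
  obtain u v where r: "r = (u, v)" by (cases r)
  show ?case
    using cc_equiv.cancel[of "x * u" z "y * v"]
    by (simp add: r fracpair_alg_def ac_simps)
qed (auto intro: cc_equiv.intros)

lemma fracpair_add_commute: "add_op fracpair_alg p q = add_op fracpair_alg q p"
  by (cases p; cases q) (simp add: fracpair_alg_def ac_simps)

lemma fracpair_mul_commute: "mul_op fracpair_alg p q = mul_op fracpair_alg q p"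
  by (cases p; cases q) (simp add: fracpair_alg_def ac_simps)

lemma cm_congruence_cc_rel: "cm_congruence fracpair_alg cc_rel"
proof -
  have "equiv (carr fracpair_alg) cc_rel"
    by (auto simp: fracpair_alg_def cc_rel_def
        intro!: equivI refl_onI symI transI intro: cc_equiv.intros)
  moreover have "cc_equiv (add_op fracpair_alg p q) (add_op fracpair_alg p' q')"
    if "cc_equiv p p'" "cc_equiv q q'" for p p' q q'
    using cc_equiv_add_left[OF that(1), of q] cc_equiv_add_left[OF that(2), of p']
    by (simp only: fracpair_add_commute[of _ p']) (rule cc_equiv.trans)
  moreover have "cc_equiv (mul_op fracpair_alg p q) (mul_op fracpair_alg p' q')"
    if "cc_equiv p p'" "cc_equiv q q'" for p p' q q'
    using cc_equiv_mul_left[OF that(1), of q] cc_equiv_mul_left[OF that(2), of p']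
    by (simp only: fracpair_mul_commute[of _ p']) (rule cc_equiv.trans)
  ultimately show ?thesis
    unfolding cm_congruence_def by (auto simp: cc_rel_def intro: cc_equiv_neg cc_equiv_inv)
qed

end

(* Every closed term t is provably equal to a quotient p / q of integer numerals, where the fracpair
  (p, q) is obtained by evaluating t in F(Z), because the fracpair operations are exactly the derivable
  laws for such quotients. Since z * z^-1 * z^-1 = z^-1 is derivable, cc-equivalent fracpairs denote
  provably equal quotients; conversely the axioms hold in F(Z) modulo cc-equivalence. So evaluation
  preserves and reflects the two congruences, and it is onto. *)
theory Submission imports Defs begin

section \<open>Quotient algebras\<close>

lemma cm_congruenceD:
  assumes "cm_congruence A R"
  shows "equiv (carr A) R"
    and "(x, x') \<in> R \<Longrightarrow> (neg_op A x, neg_op A x') \<in> R"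
    and "(x, x') \<in> R \<Longrightarrow> (inv_op A x, inv_op A x') \<in> R"
    and "(x, x') \<in> R \<Longrightarrow> (y, y') \<in> R \<Longrightarrow> (add_op A x y, add_op A x' y') \<in> R"
    and "(x, x') \<in> R \<Longrightarrow> (y, y') \<in> R \<Longrightarrow> (mul_op A x y, mul_op A x' y') \<in> R"
  using assms unfolding cm_congruence_def by blast+

lemma cm_quotient_ops:
  assumes R: "cm_congruence A R" and x: "x \<in> carr A"
  shows "neg_op (cm_quotient A R) (R `` {x}) = R `` {neg_op A x}"
    and "inv_op (cm_quotient A R) (R `` {x}) = R `` {inv_op A x}"
    and "y \<in> carr A \<Longrightarrow> add_op (cm_quotient A R) (R `` {x}) (R `` {y}) = R `` {add_op A x y}"
    and "y \<in> carr A \<Longrightarrow> mul_op (cm_quotient A R) (R `` {x}) (R `` {y}) = R `` {mul_op A x y}"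
proof -
  note R' = cm_congruenceD[OF R]
  note eq = equiv_class_eq[OF R'(1)]
  have "(\<lambda>x. R `` {neg_op A x}) respects R" "(\<lambda>x. R `` {inv_op A x}) respects R"
    by (auto intro!: congruentI eq R')
  moreover have "(\<lambda>x y. R `` {add_op A x y}) respects2 R" "(\<lambda>x y. R `` {mul_op A x y}) respects2 R"
    by (auto intro!: congruent2I' eq R')
  ultimately show "neg_op (cm_quotient A R) (R `` {x}) = R `` {neg_op A x}"
    and "inv_op (cm_quotient A R) (R `` {x}) = R `` {inv_op A x}"
    and "y \<in> carr A \<Longrightarrow> add_op (cm_quotient A R) (R `` {x}) (R `` {y}) = R `` {add_op A x y}"
    and "y \<in> carr A \<Longrightarrow> mul_op (cm_quotient A R) (R `` {x}) (R `` {y}) = R `` {mul_op A x y}"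
    using UN_equiv_class[OF R'(1) _ x] UN_equiv_class2[OF R'(1) R'(1) _ x]
    by (simp_all add: cm_quotient_def)
qed

lemma cm_quotient_simps:
  "carr (cm_quotient A R) = carr A // R"
  "zero_op (cm_quotient A R) = R `` {zero_op A}"
  "one_op (cm_quotient A R) = R `` {one_op A}"
  "err_op (cm_quotient A R) = R `` {err_op A}"
  by (simp_all add: cm_quotient_def)

lemma cm_algebra_quotient:
  assumes A: "cm_algebra A" and R: "cm_congruence A R"
  shows "cm_algebra (cm_quotient A R)"
  using A unfolding cm_algebra_def
  by (auto simp: cm_quotient_simps cm_quotient_ops[OF R] intro!: quotientI elim!: quotientE)

text \<open>The forward direction of \<open>iff\<close> makes the induced map on classes well
  defined, the backward direction makes it injective. Surjectivity of \<open>f\<close> is only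
  required up to \<open>S\<close>.\<close>

lemma cm_isomorphic_quotients:
  assumes A: "cm_algebra A" and B: "cm_algebra B"
    and R: "cm_congruence A R" and S: "cm_congruence B S"
    and f: "cm_hom A B f"
    and iff: "\<And>x y. x \<in> carr A \<Longrightarrow> y \<in> carr A \<Longrightarrow> (x, y) \<in> R \<longleftrightarrow> (f x, f y) \<in> S"
    and onto: "\<And>b. b \<in> carr B \<Longrightarrow> \<exists>x\<in>carr A. (f x, b) \<in> S"
  shows "cm_isomorphic (cm_quotient A R) (cm_quotient B S)"
proof -
  note eqR = cm_congruenceD(1)[OF R] and eqS = cm_congruenceD(1)[OF S]
  \<comment> \<open>Taking the union over all elements of the class avoids a choice of
    representative.\<close>
  define h where "h X = S `` (f ` X)" for X
  have fB: "f x \<in> carr B" if "x \<in> carr A" for x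
    using f that by (simp add: cm_hom_def)
  have h: "h (R `` {x}) = S `` {f x}" if x: "x \<in> carr A" for x
  proof
    show "S `` {f x} \<subseteq> h (R `` {x})"
      using equiv_class_self[OF eqR x] by (auto simp: h_def)
    show "h (R `` {x}) \<subseteq> S `` {f x}"
    proof
      fix b assume "b \<in> h (R `` {x})"
      then obtain y where y: "(x, y) \<in> R" and b: "(f y, b) \<in> S" by (auto simp: h_def)
      have "y \<in> carr A" using equiv_type[OF eqR] y by auto
      with y x iff have "(f x, f y) \<in> S" by blast
      with b show "b \<in> S `` {f x}" using eqS by (auto simp: equiv_def dest: transD)
    qed
  qed
  have "cm_hom (cm_quotient A R) (cm_quotient B S) h"
    using A f fB unfolding cm_hom_def cm_algebra_def
    by (auto simp: cm_quotient_simps cm_quotient_ops[OF R] cm_quotient_ops[OF S] h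
        intro!: quotientI elim!: quotientE)
  moreover have "bij_betw h (carr A // R) (carr B // S)"
  proof (rule bij_betw_imageI)
    show "inj_on h (carr A // R)"
    proof (rule inj_onI)
      fix X Y assume "X \<in> carr A // R" "Y \<in> carr A // R" and XY: "h X = h Y"
      then obtain x y where x: "x \<in> carr A" "X = R `` {x}" and y: "y \<in> carr A" "Y = R `` {y}"
        by (auto elim!: quotientE)
      have "(f x, f y) \<in> S"
        using XY x y by (simp add: h eq_equiv_class_iff[OF eqS] fB)
      then show "X = Y" using x y iff by (simp add: equiv_class_eq[OF eqR])
    qed
    show "h ` (carr A // R) = carr B // S"
    proof
      show "h ` (carr A // R) \<subseteq> carr B // S"
        by (auto simp: h fB intro!: quotientI elim!: quotientE)
      show "carr B // S \<subseteq> h ` (carr A // R)"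
      proof
        fix Y assume "Y \<in> carr B // S"
        then obtain b where b: "b \<in> carr B" and Y: "Y = S `` {b}" by (elim quotientE)
        obtain x where x: "x \<in> carr A" and "(f x, b) \<in> S" using onto[OF b] by blast
        then have "Y = h (R `` {x})" by (simp add: h Y equiv_class_eq[OF eqS])
        then show "Y \<in> h ` (carr A // R)" using quotientI[OF x] by blast
      qed
    qed
  qed
  ultimately show ?thesis
    using cm_algebra_quotient[OF A R] cm_algebra_quotient[OF B S]
    by (auto simp: cm_isomorphic_def cm_quotient_simps)
qed


section \<open>Fractions of numerals in a common meadow\<close>

text \<open>As a type class, \<open>Md_a\<close> supports ordinary equational reasoning in place of
  formal derivations. Associativity, commutativity, units and distributivity come from the
  superclasses; \<open>comm_semiring\<close> does not impose \<open>0 * x = 0\<close>.\<close>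

class common_meadow = comm_semiring + comm_monoid_add + comm_monoid_mult + inverse + uminus +
  fixes err :: 'a
  assumes cm_add_uminus: "x + - x = 0 * x"
    and cm_uminus_uminus: "- (- x) = x"
    and cm_zero_square: "0 * (x * x) = 0 * x"
    and cm_inverse_inverse: "inverse (inverse x) = x + 0 * inverse x"
    and cm_mult_inverse: "x * inverse x = 1 + 0 * inverse x"
    and cm_inverse_mult: "inverse (x * y) = inverse x * inverse y"
    and cm_inverse_one: "inverse 1 = 1"
    and cm_inverse_zero: "inverse 0 = err"
    and cm_add_err: "x + err = err"
    and cm_mult_err: "x * err = err"
    and cm_divide: "x / y = x * inverse y"
begin

section \<open>Error terms \<open>0 * x\<close> and additive inverses\<close>

lemma cm_zero_zero: "0 * 0 = 0"
  using distrib_left[of 0 1 0] by simp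

lemma cm_add_zero_mult: "x + 0 * x = x"
  using distrib_right[of 1 0 x] by simp

lemma cm_zero_idem: "0 * x + 0 * x = 0 * x"
  using distrib_right[of 0 0 x] by simp

lemma cm_zero_zero_mult: "0 * (0 * x) = 0 * x"
  by (simp add: mult.assoc[symmetric] cm_zero_zero)

text \<open>The axiom on squares turns \<open>0 * x + 0 * y\<close> into
  \<open>0 * ((x + y) * (x + y))\<close>, whose expansion contains \<open>0 * (x * y)\<close>; this
  term absorbs both \<open>0 * x\<close> and \<open>0 * y\<close>.\<close>

lemma cm_zero_mult: "0 * (x * y) = 0 * x + 0 * y"
proof -
  \<comment> \<open>Absorption comes from distributing \<open>0 * x\<close> over
    \<open>y + 0\<close>.\<close>
  have l: "0 * (x * y) + 0 * x = 0 * (x * y)" for x y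
    using distrib_left[of "0 * x" y 0]
    by (simp add: mult.assoc mult.commute[of x 0] cm_zero_zero_mult)
  have "0 * x + 0 * y = 0 * ((x + y) * (x + y))"
    by (simp only: cm_zero_square) (rule distrib_left[symmetric])
  also have "\<dots> = 0 * (x * x) + 0 * (x * y) + (0 * (x * y) + 0 * (y * y))"
    by (simp add: algebra_simps)
  also have "\<dots> = (0 * (x * y) + 0 * (x * y)) + 0 * x + 0 * y"
    by (simp only: cm_zero_square add.assoc add.commute add.left_commute)
  also have "\<dots> = 0 * (x * y) + 0 * x + 0 * y"
    by (simp add: cm_zero_idem)
  also have "\<dots> = 0 * (x * y)"
    using l[of x y] l[of y x] by (simp add: mult.commute[of y x])
  finally show ?thesis by simp
qed

lemma cm_zero_uminus: "0 * - x = 0 * x"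
  using cm_add_uminus[of "- x"] cm_add_uminus[of x] by (simp add: cm_uminus_uminus add.commute)

text \<open>Equality of the error terms has to be assumed: for \<open>x = err\<close> the first
  assumption holds for every \<open>y\<close>.\<close>

lemma cm_uminus_unique:
  assumes "x + y = 0 * x" "0 * y = 0 * x"
  shows "y = - x"
proof -
  have "y = y + 0 * x" using cm_add_zero_mult[of y] by (simp add: assms(2))
  also have "\<dots> = (x + y) + - x"
    by (simp only: cm_add_uminus[symmetric] add.assoc add.commute add.left_commute)
  also have "\<dots> = - x + 0 * - x" by (simp add: assms(1) cm_zero_uminus add.commute)
  finally show ?thesis by (simp add: cm_add_zero_mult)
qed

lemma cm_uminus_add: "- (x + y) = - x + - y"
proof (rule cm_uminus_unique[symmetric])
  have "x + y + (- x + - y) = (x + - x) + (y + - y)" by (simp only: ac_simps)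
  then show "x + y + (- x + - y) = 0 * (x + y)" by (simp add: cm_add_uminus distrib_left)
qed (simp add: distrib_left cm_zero_uminus)

lemma cm_mult_uminus: "x * - y = - (x * y)"
proof (rule cm_uminus_unique)
  have "x * y + x * - y = x * (y + - y)" by (simp add: distrib_left)
  then show "x * y + x * - y = 0 * (x * y)" by (simp add: cm_add_uminus ac_simps)
qed (simp add: cm_zero_mult cm_zero_uminus)

lemma cm_uminus_mult: "- x * y = - (x * y)"
  using cm_mult_uminus[of y x] by (simp add: mult.commute)

lemma cm_uminus_zero: "- 0 = 0"
  by (rule cm_uminus_unique[symmetric]) (simp_all add: cm_zero_zero)

lemma cm_cancel: "(x * z) / (y * (z * z)) = x / (y * z)"
proof -
  \<comment> \<open>Multiplying \<open>z * inverse z = 1 + 0 * inverse z\<close> by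
    \<open>inverse z\<close> leaves an error term equal to \<open>0 * inverse z\<close>, which
    \<open>inverse z\<close> absorbs.\<close>
  have "z * (inverse z * inverse z) = inverse z"
    by (simp add: mult.assoc[symmetric] cm_mult_inverse distrib_right)
      (simp add: mult.assoc cm_zero_square cm_add_zero_mult)
  moreover have "(x * z) / (y * (z * z)) = x * inverse y * (z * (inverse z * inverse z))"
    by (simp add: cm_divide cm_inverse_mult ac_simps)
  ultimately show ?thesis by (simp add: cm_divide cm_inverse_mult ac_simps)
qed

section \<open>Integer numerals\<close>

text \<open>\<open>of_nat\<close> and \<open>of_int\<close> are not available, since \<open>0 * x = 0\<close> fails in a common meadow.\<close>

primrec nat_num :: "nat \<Rightarrow> 'a" where
  "nat_num 0 = 0"
| "nat_num (Suc n) = 1 + nat_num n"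

text \<open>Since \<open>nat\<close> truncates at 0, at least one of the two summands is the numeral
  of 0.\<close>

definition int_num :: "int \<Rightarrow> 'a" where
  "int_num i = nat_num (nat i) + - nat_num (nat (- i))"

lemma nat_num_add: "nat_num (m + n) = nat_num m + nat_num n"
  by (induction m) (simp_all add: add.assoc)

text \<open>Numerals carry no error term, so \<open>nat_num n + - nat_num n\<close> is 0 and the
  usual cancellation is available among them.\<close>

lemma zero_nat_num: "0 * nat_num n = 0"
  by (induction n) (simp_all add: cm_zero_zero distrib_left)

lemma nat_num_mult: "nat_num (m * n) = nat_num m * nat_num n"
  by (induction m) (simp_all add: zero_nat_num nat_num_add distrib_right)

text \<open>Allows an integer to be written as any difference of naturals, so that sums and products
  need no case distinction on signs.\<close>

lemma int_num_diff: "int_num (int m - int n) = nat_num m + - nat_num n"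
proof (cases "n \<le> m")
  case True
  then obtain k where m: "m = n + k" by (auto simp: le_iff_add)
  have "nat_num m + - nat_num n = nat_num k + (nat_num n + - nat_num n)"
    by (simp add: m nat_num_add ac_simps)
  then show ?thesis by (simp add: int_num_def m cm_add_uminus zero_nat_num cm_uminus_zero)
next
  case False
  then obtain k where n: "n = m + k" by (auto simp: not_le less_iff_Suc_add)
  have "nat_num m + - nat_num n = - nat_num k + (nat_num m + - nat_num m)"
    by (simp add: n nat_num_add cm_uminus_add ac_simps)
  then show ?thesis by (simp add: int_num_def n cm_add_uminus zero_nat_num)
qed

lemma zero_int_num: "0 * int_num i = 0"
  by (simp add: int_num_def distrib_left cm_zero_uminus zero_nat_num)

lemma int_num_0: "int_num 0 = 0" and int_num_1: "int_num 1 = 1"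
  by (simp_all add: int_num_def cm_uminus_zero)

lemma int_num_uminus: "int_num (- i) = - int_num i"
  by (simp add: int_num_def cm_uminus_add cm_uminus_uminus add.commute)

lemma int_num_add: "int_num (i + j) = int_num i + int_num j"
proof -
  obtain a b c d where i: "i = int a - int b" and j: "j = int c - int d"
    by (meson int_diff_cases)
  have "i + j = int (a + c) - int (b + d)" by (simp add: i j)
  then have "int_num (i + j) = nat_num (a + c) + - nat_num (b + d)"
    by (simp only: int_num_diff)
  then show ?thesis unfolding i j int_num_diff
    by (simp add: nat_num_add cm_uminus_add ac_simps)
qed

lemma int_num_mult: "int_num (i * j) = int_num i * int_num j"
proof -
  obtain a b c d where i: "i = int a - int b" and j: "j = int c - int d"
    by (meson int_diff_cases)
  have "i * j = int (a * c + b * d) - int (a * d + b * c)" by (simp add: i j algebra_simps)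
  then have "int_num (i * j) = nat_num (a * c + b * d) + - nat_num (a * d + b * c)"
    by (simp only: int_num_diff)
  then show ?thesis unfolding i j int_num_diff
    by (simp add: nat_num_add nat_num_mult cm_uminus_add cm_mult_uminus cm_uminus_mult
        cm_uminus_uminus distrib_left distrib_right ac_simps)
qed

section \<open>Fractions and the fracpair operations\<close>

definition frac :: "int \<times> int \<Rightarrow> 'a" where
  "frac p = int_num (fst p) / int_num (snd p)"

lemma frac_cc_equiv: "cc_equiv p q \<Longrightarrow> frac p = frac q"
  by (induction rule: cc_equiv.induct) (simp_all add: frac_def int_num_mult cm_cancel)

lemma frac_consts:
  "frac (zero_op fracpair_alg) = 0"
  "frac (one_op fracpair_alg) = 1"
  "frac (err_op fracpair_alg) = err"
  by (simp_all add: fracpair_alg_def frac_def int_num_0 int_num_1 cm_divide cm_inverse_one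
      cm_inverse_zero)

lemma frac_neg: "frac (neg_op fracpair_alg p) = - frac p"
  by (cases p) (simp add: fracpair_alg_def frac_def int_num_uminus cm_divide cm_uminus_mult)

lemma frac_mul: "frac (mul_op fracpair_alg p q) = frac p * frac q"
  by (cases p; cases q)
    (simp add: fracpair_alg_def frac_def int_num_mult cm_divide cm_inverse_mult ac_simps)

text \<open>Cancelling \<open>x\<close> against \<open>inverse x\<close> costs the error term
  \<open>0 * inverse x\<close>; the numeral factor disappears from it because
  \<open>0 * int_num i = 0\<close>.\<close>

lemma int_num_mult_mult_inverse:
  "int_num i * (x * inverse x) = int_num i + 0 * inverse x"
proof -
  have "int_num i * (x * inverse x) = int_num i + (0 * int_num i) * inverse x"
    by (simp add: cm_mult_inverse distrib_left ac_simps)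
  then show ?thesis by (simp add: zero_int_num)
qed

text \<open>The extra factor \<open>y\<close> in the inverse of a fracpair records the error term:
  for a numeral \<open>y\<close>, \<open>y * (y * inverse y)\<close> and
  \<open>inverse (inverse y)\<close> both equal \<open>y + 0 * inverse y\<close>.\<close>

lemma frac_inv: "frac (inv_op fracpair_alg p) = inverse (frac p)"
proof (cases p)
  case (Pair x y)
  let ?x = "int_num x" and ?y = "int_num y"
  have "frac (inv_op fracpair_alg p) = inverse ?x * (?y * (?y * inverse ?y))"
    by (simp add: Pair fracpair_alg_def frac_def int_num_mult cm_divide cm_inverse_mult ac_simps)
  then show ?thesis
    by (simp add: Pair frac_def cm_divide cm_inverse_mult cm_inverse_inverse
        int_num_mult_mult_inverse)
qed

lemma frac_add: "frac (add_op fracpair_alg p q) = frac p + frac q"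
proof -
  obtain x y u v where p: "p = (x, y)" and q: "q = (u, v)" by (cases p; cases q)
  let ?x = "int_num x" and ?y = "int_num y" and ?u = "int_num u" and ?v = "int_num v"
  have "frac (add_op fracpair_alg p q) =
      ?x * (?v * inverse ?v) * inverse ?y + ?u * (?y * inverse ?y) * inverse ?v"
    by (simp add: p q fracpair_alg_def frac_def int_num_mult int_num_add cm_divide cm_inverse_mult
        distrib_left distrib_right ac_simps)
  also have "\<dots> = ?x * inverse ?y + ?u * inverse ?v
      + (0 * (inverse ?y * inverse ?v) + 0 * (inverse ?y * inverse ?v))"
    by (simp only: int_num_mult_mult_inverse distrib_right) (simp only: ac_simps)
  \<comment> \<open>The two equal error terms merge and then split by \<open>cm_zero_mult\<close>
    into \<open>0 * inverse ?y\<close> and \<open>0 * inverse ?v\<close>, each absorbed by the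
    fraction with that denominator.\<close>
  also have "\<dots> = (?x + 0) * inverse ?y + (?u + 0) * inverse ?v"
    by (simp only: cm_zero_idem)
      (simp only: cm_zero_mult distrib_right add.assoc add.commute add.left_commute)
  finally show ?thesis by (simp add: p q frac_def cm_divide)
qed

end


section \<open>Terms modulo provable equality\<close>

\<comment> \<open>Open terms are kept so that the quotient is of a full type and can be an instance
  of the class. \<open>provable_rel\<close> restricts this same relation to closed terms.\<close>
quotient_type cm_free = "nat cm_term" / "provable Md_a"
  by (auto intro!: equivpI reflpI sympI transpI intro: provable.refl provable.sym provable.trans)

lemma provable_axioms: "A \<subseteq> E \<Longrightarrow> \<forall>(s, t) \<in> A. provable E (subst \<sigma> s) (subst \<sigma> t)"
  by (auto intro: provable.ax provable.inst)

text \<open>Stated for supersets, so that unfolding \<open>Md_a\<close> leaves the conclusions intact.\<close>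

lemma Md_a_subst:
  fixes x y z :: "nat cm_term"
  assumes "Md_a \<subseteq> E"
  shows "provable E ((x \<oplus> y) \<oplus> z) (x \<oplus> (y \<oplus> z))"
    and "provable E (x \<oplus> y) (y \<oplus> x)"
    and "provable E (x \<oplus> Zero) x"
    and "provable E (x \<oplus> Neg x) (Zero \<odot> x)"
    and "provable E ((x \<odot> y) \<odot> z) (x \<odot> (y \<odot> z))"
    and "provable E (x \<odot> y) (y \<odot> x)"
    and "provable E (One \<odot> x) x"
    and "provable E (x \<odot> (y \<oplus> z)) (x \<odot> y \<oplus> x \<odot> z)"
    and "provable E (Neg (Neg x)) x"
    and "provable E (Zero \<odot> (x \<odot> x)) (Zero \<odot> x)"
    and "provable E (Inv (Inv x)) (x \<oplus> Zero \<odot> Inv x)"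
    and "provable E (x \<odot> Inv x) (One \<oplus> Zero \<odot> Inv x)"
    and "provable E (Inv (x \<odot> y)) (Inv x \<odot> Inv y)"
    and "provable E (Inv One) One"
    and "provable E (Inv Zero) Err"
    and "provable E (x \<oplus> Err) Err"
    and "provable E (x \<odot> Err) Err"
  using provable_axioms[OF assms, of "\<lambda>n. if n = 0 then x else if n = 1 then y else z"]
  unfolding Md_a_def Let_def by simp_all

instantiation cm_free :: common_meadow
begin

lift_definition zero_cm_free :: cm_free is Zero .
lift_definition one_cm_free :: cm_free is One .
lift_definition err_cm_free :: cm_free is Err .
lift_definition uminus_cm_free :: "cm_free \<Rightarrow> cm_free" is Neg by (rule provable.cong_Neg)
lift_definition inverse_cm_free :: "cm_free \<Rightarrow> cm_free" is Inv by (rule provable.cong_Inv)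
lift_definition plus_cm_free :: "cm_free \<Rightarrow> cm_free \<Rightarrow> cm_free" is Add by (rule provable.cong_Add)
lift_definition times_cm_free :: "cm_free \<Rightarrow> cm_free \<Rightarrow> cm_free" is Mul by (rule provable.cong_Mul)

definition divide_cm_free :: "cm_free \<Rightarrow> cm_free \<Rightarrow> cm_free" where
  "divide_cm_free x y = x * inverse y"

instance
proof
  fix x y z :: cm_free
  have comm: "x + y = y + x" "x * y = y * x" for x y :: cm_free
    by (transfer, rule Md_a_subst[OF subset_refl])+
  have distrib: "x * (y + z) = x * y + x * z" for x y z :: cm_free
    by (transfer, rule Md_a_subst[OF subset_refl])
  have zero: "x + 0 = x" by (transfer, rule Md_a_subst[OF subset_refl])
  show "x + y = y + x" "x * y = y * x" by (fact comm)+
  show "0 + x = x" using zero by (simp only: comm(1))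
  show "(x + y) * z = x * z + y * z" using distrib[of z x y] by (simp only: comm(2)[of z])
  show "divide x y = x * inverse y" by (fact divide_cm_free_def)
qed (transfer, rule Md_a_subst[OF subset_refl])+

end


section \<open>Evaluation of terms in fracpairs\<close>

text \<open>Variables receive values because derivations between closed terms may pass through open
  ones, starting with the axioms.\<close>

primrec eval :: "('v \<Rightarrow> int \<times> int) \<Rightarrow> 'v cm_term \<Rightarrow> int \<times> int" where
  "eval \<rho> (Var v) = \<rho> v"
| "eval \<rho> Zero = zero_op fracpair_alg"
| "eval \<rho> One = one_op fracpair_alg"
| "eval \<rho> Err = err_op fracpair_alg"
| "eval \<rho> (Neg s) = neg_op fracpair_alg (eval \<rho> s)"
| "eval \<rho> (Inv s) = inv_op fracpair_alg (eval \<rho> s)"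
| "eval \<rho> (s \<oplus> t) = add_op fracpair_alg (eval \<rho> s) (eval \<rho> t)"
| "eval \<rho> (s \<odot> t) = mul_op fracpair_alg (eval \<rho> s) (eval \<rho> t)"

lemma eval_subst: "eval \<rho> (subst \<sigma> t) = eval (\<lambda>v. eval \<rho> (\<sigma> v)) t"
  by (induction t) simp_all

lemma cc_equiv_cancelI: "a = x * z \<Longrightarrow> b = y * (z * z) \<Longrightarrow> c = x \<Longrightarrow> d = y * z \<Longrightarrow> cc_equiv (a, b) (c, d)"
  by (simp add: cc_equiv.cancel)

text \<open>Cancellation with \<open>z = 0\<close> relates every pair with denominator 0 to
  \<open>(0, 0)\<close>.\<close>

lemma cc_equiv_zero_denominator: "cc_equiv (x, 0) (y, 0)"
  using cc_equiv.cancel[of x 0 0] cc_equiv.cancel[of y 0 0]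
  by (auto intro: cc_equiv.sym cc_equiv.trans)

lemma Md_a_sound:
  assumes "(s, t) \<in> Md_a"
  shows "cc_equiv (eval \<rho> s) (eval \<rho> t)"
proof -
  obtain p q where x: "\<rho> 0 = (p, q)" by (cases "\<rho> 0")
  obtain u v where y: "\<rho> (Suc 0) = (u, v)" by (cases "\<rho> (Suc 0)")
  obtain r w where z: "\<rho> 2 = (r, w)" by (cases "\<rho> 2")
  note [simp] = fracpair_alg_def x y z algebra_simps
  show ?thesis
    using assms unfolding Md_a_def Let_def
    apply (simp only: insert_iff empty_iff prod.inject)
    apply (elim disjE conjE FalseE; hypsubst)
    apply (simp_all add: cc_equiv.refl cc_equiv_zero_denominator)
    \<comment> \<open>Five axioms remain: \<open>x + - x\<close>, distributivity,
      \<open>0 * (x * x)\<close>, the double inverse and \<open>x * inverse x\<close>. In each the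
      two values differ by one cancellation of \<open>q\<close>, the denominator of
      \<open>x\<close>.\<close>
    subgoal by (rule cc_equiv_cancelI[of _ 0 q _ 1]) simp_all
    subgoal by (rule cc_equiv.sym, rule cc_equiv_cancelI[of _ "p * (u * w + r * v)" q _ "v * w"]) simp_all
    subgoal by (rule cc_equiv_cancelI[of _ 0 q _ 1]) simp_all
    subgoal by (rule cc_equiv_cancelI[of _ "p * p * q" q _ "p * q"]) simp_all
    subgoal by (rule cc_equiv_cancelI[of _ "p * q" q _ p]) simp_all
    done
qed

lemma provable_sound: "provable Md_a s t \<Longrightarrow> cc_equiv (eval \<rho> s) (eval \<rho> t)"
\<comment> \<open>The valuation is generalised because \<open>inst\<close> changes it, by
  \<open>eval_subst\<close>.\<close>
proof (induction arbitrary: \<rho> rule: provable.induct)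
  case (inst s t \<sigma>)
  then show ?case by (simp add: eval_subst)
next
  case (cong_Add s t s' t')
  then show ?case
    using cm_congruenceD(4)[OF cm_congruence_cc_rel] by (simp add: cc_rel_def)
next
  case (cong_Mul s t s' t')
  then show ?case
    using cm_congruenceD(5)[OF cm_congruence_cc_rel] by (simp add: cc_rel_def)
qed (auto intro: Md_a_sound cc_equiv_neg cc_equiv_inv cc_equiv.refl cc_equiv.sym cc_equiv.trans)

text \<open>\<open>frac\<close> commutes with all operations, so induction over terms applies;
  closedness excludes variables.\<close>

lemma abs_cm_free_closed: "vars t = {} \<Longrightarrow> abs_cm_free t = frac (eval \<rho> t)"
  by (induction t)
    (simp_all add: frac_consts frac_neg frac_inv frac_add frac_mul
      zero_cm_free.abs_eq[symmetric] one_cm_free.abs_eq[symmetric] err_cm_free.abs_eq[symmetric]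
      uminus_cm_free.abs_eq[symmetric] inverse_cm_free.abs_eq[symmetric]
      plus_cm_free.abs_eq[symmetric] times_cm_free.abs_eq[symmetric])

lemma provable_complete:
  assumes "vars s = {}" "vars t = {}" "cc_equiv (eval \<rho> s) (eval \<rho> t)"
  shows "provable Md_a s t"
proof -
  have "abs_cm_free s = abs_cm_free t"
    using assms(1,2) frac_cc_equiv[OF assms(3)] by (simp only: abs_cm_free_closed[of _ \<rho>])
  then show ?thesis by (simp only: cm_free.abs_eq_iff)
qed

lemma eval_numeral_onto: "\<exists>t. vars t = {} \<and> eval \<rho> t = (i, 1)"
proof (induction i rule: int_induct[where k = 0])
  case base
  show ?case by (rule exI[of _ Zero]) (simp add: fracpair_alg_def)
next
  case (step1 i)
  then obtain t where "vars t = {}" "eval \<rho> t = (i, 1)" by blast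
  then show ?case by (intro exI[of _ "t \<oplus> One"]) (simp add: fracpair_alg_def)
next
  case (step2 i)
  then obtain t where "vars t = {}" "eval \<rho> t = (i, 1)" by blast
  then show ?case by (intro exI[of _ "t \<oplus> Neg One"]) (simp add: fracpair_alg_def)
qed

lemma eval_onto: "\<exists>t. vars t = {} \<and> eval \<rho> t = (p, q)"
proof -
  obtain s t where "vars s = {}" "eval \<rho> s = (p, 1)" "vars t = {}" "eval \<rho> t = (q, 1)"
    using eval_numeral_onto by metis
  \<comment> \<open>The inverse of \<open>(q, 1)\<close> is exactly \<open>(1, q)\<close>, also for
    \<open>q = 0\<close>, so the product is \<open>(p, q)\<close> itself.\<close>
  then show ?thesis by (intro exI[of _ "s \<odot> Inv t"]) (simp add: fracpair_alg_def)
qed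

theorem theorem2p3p4: "cm_isomorphic initial_cm F_cm"
  unfolding initial_cm_def F_cm_def
proof (rule cm_isomorphic_quotients)
  \<comment> \<open>An arbitrary valuation serves, as closed terms contain no variables.\<close>
  let ?\<rho> = "\<lambda>_ :: nat. (0, 0)"
  show "cm_algebra closed_term_alg" "cm_algebra fracpair_alg"
    by (auto simp: cm_algebra_def closed_term_alg_def fracpair_alg_def)
  show "cm_congruence closed_term_alg provable_rel" "cm_congruence fracpair_alg cc_rel"
    by (fact cm_congruence_provable_rel cm_congruence_cc_rel)+
  show "cm_hom closed_term_alg fracpair_alg (eval ?\<rho>)"
    by (simp add: cm_hom_def closed_term_alg_def) (simp add: fracpair_alg_def)
  show "(s, t) \<in> provable_rel \<longleftrightarrow> (eval ?\<rho> s, eval ?\<rho> t) \<in> cc_rel"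
    if "s \<in> carr closed_term_alg" "t \<in> carr closed_term_alg" for s t
    using that provable_sound provable_complete
    by (auto simp: closed_term_alg_def provable_rel_def cc_rel_def)
  show "\<exists>t\<in>carr closed_term_alg. (eval ?\<rho> t, p) \<in> cc_rel" for p
    using eval_onto[of ?\<rho> "fst p" "snd p"]
    by (force simp: closed_term_alg_def cc_rel_def intro: cc_equiv.refl)
qed

end
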